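(* Let $f:2^U\to\mathbb{R}_{\ge0}$ be monotone submodular, $U$ partitioned into $U_1,\dots,U_N$, and $k_1,\dots,k_N$ positive integers with $k_j\le|U_j|$ and $\gcd(k_1,\dots,k_N)=c$. Let $\mathcal{P}=\{S\subseteq U:|S\cap U_i|\le k_i\ \forall i\in[N]\}$. Run Block-Greedy with subroutine Greedy-Subroutine-Mono (described in the context) with $\phi=c$ and $r_j=k_j/c$ for each $j\in[N]$. Then its output $S$ satisfies $f(S)\ge(1-1/e-1/c)f(OPT)$, where $OPT\in\arg\max_{S\in\mathcal{P}}f(S)$.
   Context: $f$ submodular: $f(A\cup\{x\})-f(A)\ge f(B\cup\{x\})-f(B)$ for $A\subseteq B\subseteq U$, $x\notin B$; monotone: $f(X)\le f(Y)$ for $X\subseteq Y$; $\Delta f(S,x)=f(S\cup\{x\})-f(S)$. Block-Greedy with Greedy-Subroutine-Mono and parameters $\phi,r_1,\dots,r_N$: $S\gets\emptyset$; for $i=1,\dots,\phi$: for $j=1,\dots,N$: repeat $r_j$ times: $S\gets S\cup\{\arg\max_{x\in U_j}\Delta f(S,x)\}$. Return $S$. *)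

theory Defs
  imports Complex_Main "HOL-Library.Disjoint_Sets"
begin

definition submodular_on :: "'a set \<Rightarrow> ('a set \<Rightarrow> real) \<Rightarrow> bool" where
  "submodular_on U f \<longleftrightarrow>
     (\<forall>A B x. A \<subseteq> B \<longrightarrow> B \<subseteq> U \<longrightarrow> x \<in> U \<longrightarrow> x \<notin> B \<longrightarrow>
        f (A \<union> {x}) - f A \<ge> f (B \<union> {x}) - f B)"

definition marginal_gain :: "('a set \<Rightarrow> real) \<Rightarrow> 'a set \<Rightarrow> 'a \<Rightarrow> real" where
  "marginal_gain f S x = f (S \<union> {x}) - f S"

text \<open>
  The algorithms are relations between the current set and the set obtained, because the
  arg max may be attained by several elements: every way of breaking ties is allowed.
  The maximum ranges over all of \<open>V\<close>, so an element already in \<open>S\<close> (of gain 0) may be selected.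
\<close>

definition greedy_step :: "('a set \<Rightarrow> real) \<Rightarrow> 'a set \<Rightarrow> 'a set \<Rightarrow> 'a set \<Rightarrow> bool" where
  "greedy_step f V S S' \<longleftrightarrow>
     (\<exists>x. is_arg_max (marginal_gain f S) (\<lambda>y. y \<in> V) x \<and> S' = S \<union> {x})"

definition greedy_subroutine_mono ::
    "('a set \<Rightarrow> real) \<Rightarrow> 'a set \<Rightarrow> nat \<Rightarrow> 'a set \<Rightarrow> 'a set \<Rightarrow> bool" where
  "greedy_subroutine_mono f V r = greedy_step f V ^^ r"

text \<open>
  \<open>sub V r S S'\<close> means that the subroutine, run on the part \<open>V\<close> with budget \<open>r\<close>,
  can turn \<open>S\<close> into \<open>S'\<close>. Parts are indexed from 1.
\<close>

primrec block_round ::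
    "('a set \<Rightarrow> nat \<Rightarrow> 'a set \<Rightarrow> 'a set \<Rightarrow> bool) \<Rightarrow> (nat \<Rightarrow> 'a set) \<Rightarrow> (nat \<Rightarrow> nat) \<Rightarrow> nat
      \<Rightarrow> 'a set \<Rightarrow> 'a set \<Rightarrow> bool" where
  "block_round sub V r 0 = (=)"
| "block_round sub V r (Suc j) = block_round sub V r j OO sub (V (Suc j)) (r (Suc j))"

definition block_greedy_output ::
    "('a set \<Rightarrow> nat \<Rightarrow> 'a set \<Rightarrow> 'a set \<Rightarrow> bool) \<Rightarrow> (nat \<Rightarrow> 'a set) \<Rightarrow> nat \<Rightarrow> nat \<Rightarrow> (nat \<Rightarrow> nat)
      \<Rightarrow> 'a set \<Rightarrow> bool" where
  "block_greedy_output sub V N \<phi> r S \<longleftrightarrow> (block_round sub V r N ^^ \<phi>) {} S"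

definition partition_matroid_sets ::
    "'a set \<Rightarrow> (nat \<Rightarrow> 'a set) \<Rightarrow> nat \<Rightarrow> (nat \<Rightarrow> nat) \<Rightarrow> 'a set set" where
  "partition_matroid_sets U V N k = {S. S \<subseteq> U \<and> (\<forall>i\<in>{1..N}. card (S \<inter> V i) \<le> k i)}"

end

theory Submission imports Defs begin

text \<open>
  Let \<open>A\<close> and \<open>A'\<close> be the sets before and after one round. Each greedy step on part \<open>j\<close> gains at
  least \<open>\<Delta>f(A', y)\<close> for every \<open>y\<close> in that part: the step maximizes the gain with respect to a
  subset of \<open>A'\<close>, and marginal gains decrease. The round makes \<open>k\<^sub>j / c\<close> steps on part \<open>j\<close>, while
  \<open>OPT\<close> has at most \<open>k\<^sub>j\<close> elements there, so
  \<open>c (f A' - f A) \<ge> (\<Sum>y\<in>OPT. \<Delta>f(A', y)) \<ge> f OPT - f A'\<close>. Hence each round shrinks the deficit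
  \<open>f OPT - f A\<close> by the factor \<open>c / (c + 1)\<close>, and \<open>(c / (c + 1)) ^ c \<le> 1/e + 1/c\<close>.
\<close>

locale monotone_submodular =
  fixes U :: "'a set" and f :: "'a set \<Rightarrow> real"
  assumes mono: "mono_on (Pow U) f"
    and submodular: "submodular_on U f"
begin

lemma f_mono: "X \<subseteq> Y \<Longrightarrow> Y \<subseteq> U \<Longrightarrow> f X \<le> f Y"
  using mono by (auto simp: mono_on_def)

text \<open>Submodularity only covers \<open>y\<close> outside \<open>B\<close>. For
  \<open>y\<close> in \<open>B\<close> the gain over \<open>B\<close> is 0, and monotonicity makes
  the gain over \<open>A\<close> nonnegative. This case matters because the elements to be compared
  may already have been selected.\<close>

lemma marginal_gain_antimono:
  assumes "A \<subseteq> B" "B \<subseteq> U" "y \<in> U"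
  shows "marginal_gain f B y \<le> marginal_gain f A y"
proof (cases "y \<in> B")
  case True
  then have "B \<union> {y} = B" by blast
  moreover have "f A \<le> f (A \<union> {y})"
    using assms by (intro f_mono) auto
  ultimately show ?thesis
    by (simp add: marginal_gain_def)
next
  case False
  then show ?thesis
    using submodular assms unfolding submodular_on_def marginal_gain_def by blast
qed

text \<open>Add the elements of \<open>X\<close> to \<open>A\<close> one at a time and telescope:
  each gains at most what it would gain over \<open>A\<close> alone.\<close>

lemma diff_le_sum_marginal_gain:
  assumes "finite X" "X \<subseteq> U" "A \<subseteq> U"
  shows "f (A \<union> X) - f A \<le> (\<Sum>y\<in>X. marginal_gain f A y)"
  using assms
proof (induction X rule: finite_induct)
  case empty
  then show ?case by simp
next
  case (insert x X)
  have "marginal_gain f (A \<union> X) x \<le> marginal_gain f A x"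
    using insert.prems by (intro marginal_gain_antimono) auto
  then show ?case
    using insert by (simp add: marginal_gain_def)
qed

lemma greedy_step_gain:
  assumes "greedy_step f W A A'" "W \<subseteq> U" "A \<subseteq> U"
  shows "A \<subseteq> A'" "A' \<subseteq> U"
    and "y \<in> W \<Longrightarrow> marginal_gain f A y \<le> f A' - f A"
proof -
  obtain x where x: "is_arg_max (marginal_gain f A) (\<lambda>y. y \<in> W) x" "A' = A \<union> {x}"
    using assms(1) by (auto simp: greedy_step_def)
  then show "A \<subseteq> A'" "A' \<subseteq> U"
    using assms by (auto simp: is_arg_max_def)
  show "marginal_gain f A y \<le> f A' - f A" if "y \<in> W"
    using x that unfolding is_arg_max_linorder by (auto simp: marginal_gain_def)
qed

text \<open>The bound is stated for every \<open>T\<close> above \<open>A'\<close>, not just for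
  \<open>A'\<close>, so that it survives later steps: the induction needs it for \<open>T\<close>
  beyond \<open>B\<close>, and a round evaluates it at the set reached after all parts are
  processed.\<close>

lemma greedy_subroutine_mono_gain:
  assumes "greedy_subroutine_mono f W r A A'" "W \<subseteq> U" "A \<subseteq> U"
  shows "A \<subseteq> A' \<and> A' \<subseteq> U \<and>
    (\<forall>T y. A' \<subseteq> T \<longrightarrow> T \<subseteq> U \<longrightarrow> y \<in> W \<longrightarrow> real r * marginal_gain f T y \<le> f A' - f A)"
  using assms(1) unfolding greedy_subroutine_mono_def
proof (induction r arbitrary: A')
  case 0
  then show ?case using assms by simp
next
  case (Suc r)
  obtain B where B: "(greedy_step f W ^^ r) A B" "greedy_step f W B A'"
    using Suc.prems by auto
  have IH: "A \<subseteq> B" "B \<subseteq> U"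
    "\<And>T y. B \<subseteq> T \<Longrightarrow> T \<subseteq> U \<Longrightarrow> y \<in> W \<Longrightarrow> real r * marginal_gain f T y \<le> f B - f A"
    using Suc.IH[OF B(1)] by simp_all
  note step = greedy_step_gain[OF B(2) assms(2) IH(2)]
  have "real (Suc r) * marginal_gain f T y \<le> f A' - f A"
    if "A' \<subseteq> T" "T \<subseteq> U" "y \<in> W" for T y
  proof -
    have "real r * marginal_gain f T y \<le> f B - f A"
      using step(1) that by (intro IH(3)) auto
    moreover have "marginal_gain f T y \<le> marginal_gain f B y"
      using step(1) that assms(2) by (intro marginal_gain_antimono) auto
    moreover have "marginal_gain f B y \<le> f A' - f B"
      using that(3) by (rule step(3))
    ultimately show ?thesis
      by (simp add: algebra_simps)
  qed
  then show ?case
    using IH(1) step(1,2) by simp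
qed

text \<open>All parts are compared at one common \<open>T\<close>, although each is processed from a
  different set; the increases of \<open>f\<close> over the parts then telescope. \<open>X\<close>
  plays the role of the optimum.\<close>

lemma block_round_gain:
  assumes "block_round (greedy_subroutine_mono f) V r n A A'" "A \<subseteq> U"
    and "\<And>j. j \<in> {1..n} \<Longrightarrow> V j \<subseteq> U"
    and "\<And>j. j \<in> {1..n} \<Longrightarrow> 0 < r j"
    and "\<And>j. j \<in> {1..n} \<Longrightarrow> card (X \<inter> V j) \<le> c * r j"
  shows "A \<subseteq> A' \<and> A' \<subseteq> U \<and>
    (\<forall>T. A' \<subseteq> T \<longrightarrow> T \<subseteq> U \<longrightarrow>
      (\<Sum>j\<in>{1..n}. \<Sum>y\<in>X \<inter> V j. marginal_gain f T y) \<le> real c * (f A' - f A))"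
  using assms(1,3-)
proof (induction n arbitrary: A')
  case 0
  then show ?case using assms(2) by simp
next
  case (Suc n)
  let ?j = "Suc n"
  obtain B where B: "block_round (greedy_subroutine_mono f) V r n A B"
      "greedy_subroutine_mono f (V ?j) (r ?j) B A'"
    using Suc.prems(1) by auto
  have "A \<subseteq> B \<and> B \<subseteq> U \<and>
    (\<forall>T. B \<subseteq> T \<longrightarrow> T \<subseteq> U \<longrightarrow>
      (\<Sum>j\<in>{1..n}. \<Sum>y\<in>X \<inter> V j. marginal_gain f T y) \<le> real c * (f B - f A))"
    by (rule Suc.IH[OF B(1)]) (use Suc.prems(2-) in simp_all)
  then have IH: "A \<subseteq> B" "B \<subseteq> U"
    "\<And>T. B \<subseteq> T \<Longrightarrow> T \<subseteq> U \<Longrightarrow>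
      (\<Sum>j\<in>{1..n}. \<Sum>y\<in>X \<inter> V j. marginal_gain f T y) \<le> real c * (f B - f A)"
    by simp_all
  have "V ?j \<subseteq> U" using Suc.prems(2)[of ?j] by simp
  then have sub: "B \<subseteq> A'" "A' \<subseteq> U"
    "\<And>T y. A' \<subseteq> T \<Longrightarrow> T \<subseteq> U \<Longrightarrow> y \<in> V ?j \<Longrightarrow>
      real (r ?j) * marginal_gain f T y \<le> f A' - f B"
    using greedy_subroutine_mono_gain[OF B(2) _ IH(2)] by simp_all
  have "(\<Sum>j\<in>{1..?j}. \<Sum>y\<in>X \<inter> V j. marginal_gain f T y) \<le> real c * (f A' - f A)"
    if T: "A' \<subseteq> T" "T \<subseteq> U" for T
  proof -
    \<comment> \<open>\<open>g\<close> is the average increase per greedy step on this part, hence a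
      bound for every marginal gain over \<open>T\<close> there. Its nonnegativity allows the number
      of elements to be replaced by the upper bound \<open>c * r ?j\<close>.\<close>
    define g where "g = (f A' - f B) / real (r ?j)"
    have r: "real (r ?j) > 0" using Suc.prems(3)[of ?j] by simp
    have "f B \<le> f A'" using sub(1,2) by (rule f_mono)
    then have "0 \<le> g" by (simp add: g_def)
    have "(\<Sum>y\<in>X \<inter> V ?j. marginal_gain f T y) \<le> real (card (X \<inter> V ?j)) * g"
      using sub(3)[OF T] r
      by (intro sum_bounded_above) (auto simp: g_def pos_le_divide_eq mult.commute)
    also have "\<dots> \<le> real (c * r ?j) * g"
      using Suc.prems(4)[of ?j] \<open>0 \<le> g\<close> by (intro mult_right_mono of_nat_mono) auto
    also have "\<dots> = real c * (f A' - f B)"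
      using r by (simp add: g_def)
    finally have "(\<Sum>y\<in>X \<inter> V ?j. marginal_gain f T y) \<le> real c * (f A' - f B)" .
    moreover have "(\<Sum>j\<in>{1..n}. \<Sum>y\<in>X \<inter> V j. marginal_gain f T y) \<le> real c * (f B - f A)"
      using sub(1) T by (intro IH(3)) auto
    ultimately show ?thesis
      by (simp add: algebra_simps)
  qed
  then show ?case
    using IH(1) sub(1,2) by simp
qed

lemma block_round_deficit:
  assumes "block_round (greedy_subroutine_mono f) V r N A A'" "A \<subseteq> U"
    and "finite U" "(\<Union>j\<in>{1..N}. V j) = U" "disjoint_family_on V {1..N}"
    and "\<And>j. j \<in> {1..N} \<Longrightarrow> 0 < r j"
    and "X \<subseteq> U" "\<And>j. j \<in> {1..N} \<Longrightarrow> card (X \<inter> V j) \<le> c * r j"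
  shows "A' \<subseteq> U"
    and "(real c + 1) * (f X - f A') \<le> real c * (f X - f A)"
proof -
  have "A \<subseteq> A' \<and> A' \<subseteq> U \<and> (\<forall>T. A' \<subseteq> T \<longrightarrow> T \<subseteq> U \<longrightarrow>
      (\<Sum>j\<in>{1..N}. \<Sum>y\<in>X \<inter> V j. marginal_gain f T y) \<le> real c * (f A' - f A))"
    using assms by (intro block_round_gain[OF assms(1)]) auto
  then have A': "A' \<subseteq> U"
    and gain: "(\<Sum>j\<in>{1..N}. \<Sum>y\<in>X \<inter> V j. marginal_gain f A' y) \<le> real c * (f A' - f A)"
    by blast+
  show "A' \<subseteq> U" by (rule A')
  have "finite X" using assms(3,7) finite_subset by blast
  have "f X \<le> f (A' \<union> X)"
    using A' assms(7) by (intro f_mono) auto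
  also have "\<dots> - f A' \<le> (\<Sum>y\<in>X. marginal_gain f A' y)"
    using \<open>finite X\<close> assms(7) A' by (rule diff_le_sum_marginal_gain)
  also have "\<dots> = (\<Sum>y\<in>(\<Union>j\<in>{1..N}. X \<inter> V j). marginal_gain f A' y)"
    using assms(4,7) by (intro sum.cong) auto
  also have "\<dots> = (\<Sum>j\<in>{1..N}. \<Sum>y\<in>X \<inter> V j. marginal_gain f A' y)"
    using \<open>finite X\<close> assms(5)
    by (intro sum.UNION_disjoint) (auto simp: disjoint_family_on_def)
  finally have "f X - f A' \<le> real c * (f A' - f A)"
    using gain by simp
  \<comment> \<open>The increase \<open>f A' - f A\<close> is the old deficit minus the new
    one.\<close>
  then show "(real c + 1) * (f X - f A') \<le> real c * (f X - f A)"
    by (simp add: algebra_simps)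
qed

text \<open>Iterates the contraction of one round. Only the ratio has to be nonnegative; the deficit
  may have either sign.\<close>

lemma block_rounds_deficit:
  assumes "(block_round (greedy_subroutine_mono f) V r N ^^ n) {} A"
    and "finite U" "(\<Union>j\<in>{1..N}. V j) = U" "disjoint_family_on V {1..N}"
    and "\<And>j. j \<in> {1..N} \<Longrightarrow> 0 < r j"
    and "X \<subseteq> U" "\<And>j. j \<in> {1..N} \<Longrightarrow> card (X \<inter> V j) \<le> c * r j"
  shows "A \<subseteq> U \<and> f X - f A \<le> (real c / (real c + 1)) ^ n * (f X - f {})"
  using assms(1)
proof (induction n arbitrary: A)
  case 0
  then show ?case by simp
next
  case (Suc n)
  obtain B where B: "(block_round (greedy_subroutine_mono f) V r N ^^ n) {} B"
      "block_round (greedy_subroutine_mono f) V r N B A"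
    using Suc.prems by auto
  note IH = Suc.IH[OF B(1)]
  then have "B \<subseteq> U" ..
  note round = block_round_deficit[OF B(2) this assms(2-)]
  have "f X - f A \<le> (real c / (real c + 1)) * (f X - f B)"
    using round(2) by (simp add: field_simps)
  also have "\<dots> \<le> (real c / (real c + 1)) * ((real c / (real c + 1)) ^ n * (f X - f {}))"
    using IH by (intro mult_left_mono) auto
  finally show ?case
    using round(1) by simp
qed

end

text \<open>Since \<open>q = 1 - 1 / (c + 1)\<close>, the natural exponent is \<open>c + 1\<close>,
  for which \<open>1 + x \<le> exp x\<close> gives the bound \<open>1/e\<close>. The missing factor
  \<open>q\<close> is what costs the extra \<open>1/c\<close>.\<close>

lemma power_ratio_le:
  assumes "c > 0"
  shows "(real c / (real c + 1)) ^ c \<le> 1 / exp 1 + 1 / real c"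
proof -
  define q where "q = real c / (real c + 1)"
  have q: "0 < q" using assms by (simp add: q_def)
  have "1 - 1 / (real c + 1) \<le> exp (- (1 / (real c + 1)))"
    using exp_ge_add_one_self[of "- (1 / (real c + 1))"] by simp
  then have "q \<le> exp (- (1 / (real c + 1)))"
    by (simp add: q_def field_simps)
  then have "q ^ Suc c \<le> exp (- (1 / (real c + 1))) ^ Suc c"
    using q by (intro power_mono) auto
  also have "\<dots> = exp (real (Suc c) * - (1 / (real c + 1)))"
    by (rule exp_of_nat_mult[symmetric])
  also have "real (Suc c) * - (1 / (real c + 1)) = - 1"
    by (simp add: field_simps)
  finally have *: "q ^ Suc c \<le> exp (- 1)" .
  have "q ^ c = q ^ Suc c / q"
    using q by simp
  also have "\<dots> \<le> exp (- 1) / q"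
    using * q by (intro divide_right_mono) auto
  \<comment> \<open>Dividing by \<open>q\<close> means multiplying by
    \<open>1 + 1/c\<close>.\<close>
  also have "\<dots> = exp (- 1) + exp (- 1) / real c"
    using assms by (simp add: q_def field_simps)
  also have "\<dots> \<le> exp (- 1) + 1 / real c"
    by (intro add_left_mono divide_right_mono) auto
  finally show ?thesis
    by (simp add: q_def exp_minus inverse_eq_divide)
qed

theorem theorem9:
  fixes U :: "'a set" and V :: "nat \<Rightarrow> 'a set" and f :: "'a set \<Rightarrow> real"
    and N c :: nat and k :: "nat \<Rightarrow> nat" and S OPT :: "'a set"
  assumes "finite U"
    and "\<forall>X\<subseteq>U. 0 \<le> f X"
    and "mono_on (Pow U) f"
    and "submodular_on U f"
    and "N \<ge> 1"
    and "(\<Union>j\<in>{1..N}. V j) = U"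
    and "disjoint_family_on V {1..N}"
    and "\<forall>j\<in>{1..N}. 0 < k j \<and> k j \<le> card (V j)"
    and "Gcd (k ` {1..N}) = c"
    and "block_greedy_output (greedy_subroutine_mono f) V N c (\<lambda>j. k j div c) S"
    and "is_arg_max f (\<lambda>X. X \<in> partition_matroid_sets U V N k) OPT"
  shows "f S \<ge> (1 - 1 / exp 1 - 1 / real c) * f OPT"
proof -
  interpret monotone_submodular U f
    using assms(3,4) by unfold_locales
  have dvd: "c dvd k j" if "j \<in> {1..N}" for j
    using that assms(9) by auto
  \<comment> \<open>A gcd of 0 would force \<open>k 1 = 0\<close>; \<open>N \<ge> 1\<close> ensures
    that part 1 exists.\<close>
  have "c > 0"
    using dvd[of 1] assms(5) assms(8)[rule_format, of 1] by (intro Nat.gr0I) auto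
  have OPT: "OPT \<subseteq> U" "\<And>j. j \<in> {1..N} \<Longrightarrow> card (OPT \<inter> V j) \<le> k j"
    using assms(11) by (auto simp: is_arg_max_def partition_matroid_sets_def)
  have "f OPT - f S \<le> (real c / (real c + 1)) ^ c * (f OPT - f {})"
  proof (rule block_rounds_deficit[THEN conjunct2])
    show "(block_round (greedy_subroutine_mono f) V (\<lambda>j. k j div c) N ^^ c) {} S"
      using assms(10) by (simp add: block_greedy_output_def)
    show "0 < k j div c" if "j \<in> {1..N}" for j
      using that dvd assms(8) by (metis dvd_div_eq_0_iff neq0_conv)
    \<comment> \<open>The division is exact, so the \<open>c\<close> rounds together have precisely
      the budget \<open>k j\<close>.\<close>
    show "card (OPT \<inter> V j) \<le> c * (k j div c)" if "j \<in> {1..N}" for j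
      using that dvd OPT(2) by simp
  qed (use assms OPT in auto)
  \<comment> \<open>Nonnegativity of \<open>f {}\<close> lets the initial deficit be bounded by
    \<open>f OPT\<close>.\<close>
  also have "\<dots> \<le> (real c / (real c + 1)) ^ c * f OPT"
    using assms(2) by (intro mult_left_mono) auto
  also have "\<dots> \<le> (1 / exp 1 + 1 / real c) * f OPT"
    using power_ratio_le[OF \<open>c > 0\<close>] assms(2) OPT(1) by (intro mult_right_mono) auto
  finally show ?thesis
    by (simp add: algebra_simps)
qed

end
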